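(* Let $M=(M(j,k))_{j,k\in\mathbb{N}_0}$ be an infinite matrix with real entries which is positive semidefinite and satisfies $M(0,0)=1$. Let $\Omega=\prod_{\mathbb{N}_0}\overline{\mathbb{R}}$ and let $$\Omega_{Han}=\{\omega\in\Omega : \omega(k)=[\omega(1)]^k \text{ for all } k\in\mathbb{N}_0\}.$$ Then there exists a probability measure $P_{Han}$ on $\Omega_{Han}$ having $M$ as its moment matrix, i.e. such that $$M(j,k)=\int_{\Omega_{Han}}\omega(j)\,\omega(k)\,\mathrm{d}P_{Han}(\omega)\qquad\text{for all } j,k\in\mathbb{N}_0,$$ if and only if $M$ is a Hankel matrix.
   Context: $\mathbb{N}_0=\{0,1,2,\dots\}$. $\overline{\mathbb{R}}$ is the one-point compactification of $\mathbb{R}$ (with $x^0=1$ for all $x$, and $\infty^k=\infty$ for $k\ge1$), and $\Omega$ is the space of all functions $\omega:\mathbb{N}_0\to\overline{\mathbb{R}}$ with the product Borel $\sigma$-algebra. The real infinite matrix $M$ is positive semidefinite if $\sum_{j}\sum_{k}\overline{c}_j M(j,k)c_k\ge 0$ for every sequence $c=(c_k)_{k\in\mathbb{N}_0}$ with only finitely many nonzero entries. $M$ is a Hankel matrix if $M(i,j)=M(i+k,j-k)=M(i-k,j+k)$ for all $k$ for which these entries are defined, i.e. $M(i,j)$ depends only on $i+j$. The integrals are required to be absolutely convergent (so in particular $\omega(1)$ is finite $P_{Han}$-almost everywhere). *)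

theory Defs
  imports "HOL-Probability.Probability" "HOL-Library.Complex_Order"
begin

text \<open>The one-point compactification of the real line has carrier \<^typ>\<open>real option\<close>, the point
  at infinity being \<^term>\<open>None\<close>; its topology is the library's
  \<^term>\<open>Alexandroff_compactification euclideanreal\<close>.\<close>

type_synonym rbar = "real option"

definition rbar_borel :: "rbar measure" where
  "rbar_borel = sigma UNIV {U. openin (Alexandroff_compactification euclideanreal) U}"

lemma topspace_rbar: "topspace (Alexandroff_compactification euclideanreal) = (UNIV :: rbar set)"
  by (metis UNIV_option_conv topspace_Alexandroff_compactification topspace_euclidean)

fun rbar_power :: "rbar \<Rightarrow> nat \<Rightarrow> rbar" where
  "rbar_power (Some x) k = Some (x ^ k)"
| "rbar_power None k = (if k = 0 then Some 1 else None)"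

text \<open>Products with a factor infinity are infinity. For 0 times infinity this is a mere
  convention: on the set \<open>Omega_Han\<close> below that product never occurs between coordinates
  (see \<open>Omega_Han_mult\<close>).\<close>

fun rbar_mult :: "rbar \<Rightarrow> rbar \<Rightarrow> rbar" where
  "rbar_mult (Some x) (Some y) = Some (x * y)"
| "rbar_mult _ _ = None"

fun rbar_abs :: "rbar \<Rightarrow> ennreal" where
  "rbar_abs (Some x) = ennreal \<bar>x\<bar>"
| "rbar_abs None = \<infinity>"

fun rbar_real :: "rbar \<Rightarrow> real" where
  "rbar_real (Some x) = x"
| "rbar_real None = 0"

text \<open>The integral of \<open>f\<close> converges absolutely and has value \<open>v\<close>. Finiteness of the integral of the
  absolute value forces \<open>f\<close> to be finite almost everywhere, so the value that \<^const>\<open>rbar_real\<close>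
  takes at infinity does not influence \<open>v\<close>.\<close>

definition rbar_has_integral :: "'a measure \<Rightarrow> ('a \<Rightarrow> rbar) \<Rightarrow> real \<Rightarrow> bool" where
  "rbar_has_integral P f v \<longleftrightarrow>
     f \<in> measurable P rbar_borel \<and>
     (\<integral>\<^sup>+ x. rbar_abs (f x) \<partial>P) < \<infinity> \<and>
     (\<integral> x. rbar_real (f x) \<partial>P) = v"

definition Omega :: "(nat \<Rightarrow> rbar) measure" where
  "Omega = PiM UNIV (\<lambda>_. rbar_borel)"

definition Omega_Han :: "(nat \<Rightarrow> rbar) set" where
  "Omega_Han = {\<omega> \<in> space Omega. \<forall>k. \<omega> k = rbar_power (\<omega> 1) k}"

lemma Omega_Han_mult:
  assumes "\<omega> \<in> Omega_Han"
  shows "rbar_mult (\<omega> j) (\<omega> k) = \<omega> (j + k)"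
    and "\<omega> j = None \<Longrightarrow> \<omega> k \<noteq> Some 0"
proof -
  have \<omega>: "\<omega> n = rbar_power (\<omega> 1) n" for n
    using assms unfolding Omega_Han_def by blast
  have "rbar_mult (rbar_power x j) (rbar_power x k) = rbar_power x (j + k)" for x
    by (cases x) (auto simp: power_add)
  then show "rbar_mult (\<omega> j) (\<omega> k) = \<omega> (j + k)"
    using \<omega> by metis
  have "rbar_power x j = None \<Longrightarrow> rbar_power x k \<noteq> Some 0" for x
    by (cases x) auto
  then show "\<omega> k \<noteq> Some 0" if "\<omega> j = None"
    using that \<omega> by metis
qed

definition prob_measure_on_Omega_Han :: "(nat \<Rightarrow> rbar) measure \<Rightarrow> bool" where
  "prob_measure_on_Omega_Han P \<longleftrightarrow>
     prob_space P \<and> sets P = sets (restrict_space Omega Omega_Han)"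

definition has_moment_matrix :: "(nat \<Rightarrow> rbar) measure \<Rightarrow> (nat \<Rightarrow> nat \<Rightarrow> real) \<Rightarrow> bool" where
  "has_moment_matrix P M \<longleftrightarrow>
     (\<forall>j k. rbar_has_integral P (\<lambda>\<omega>. rbar_mult (\<omega> j) (\<omega> k)) (M j k))"

text \<open>The test sequences are complex, and \<open>0 \<le> z\<close> for complex \<open>z\<close> means that \<open>z\<close> is real and
  nonnegative; in particular a positive semidefinite matrix is symmetric.\<close>

definition pos_semidef :: "(nat \<Rightarrow> nat \<Rightarrow> real) \<Rightarrow> bool" where
  "pos_semidef M \<longleftrightarrow>
     (\<forall>c :: nat \<Rightarrow> complex. finite {k. c k \<noteq> 0} \<longrightarrow>
        0 \<le> (\<Sum>j | c j \<noteq> 0. \<Sum>k | c k \<noteq> 0. cnj (c j) * complex_of_real (M j k) * c k))"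

definition hankel :: "(nat \<Rightarrow> nat \<Rightarrow> real) \<Rightarrow> bool" where
  "hankel M \<longleftrightarrow>
     (\<forall>i j k. (k \<le> j \<longrightarrow> M i j = M (i + k) (j - k)) \<and> (k \<le> i \<longrightarrow> M i j = M (i - k) (j + k)))"

end

theory Submission
  imports Defs "HOL-Computational_Algebra.Fundamental_Theorem_Algebra"
begin

text \<open>For a Hankel matrix \<open>M j k = m (j + k)\<close>, push forward a solution of the Hamburger moment problem
  for \<open>m\<close> along \<open>x \<mapsto> (x ^ k)\<^sub>k\<close>. To solve the moment problem, approximate any finite number of
  moments by a finitely supported distribution: otherwise a separating functional gives a
  polynomial that is nonnegative on the real line, hence a sum of two squares, on which the functional
  \<open>x ^ k \<mapsto> m k\<close> is negative. The approximating distributions are tight since their second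
  moments are bounded, and by Helly's theorem a subsequence converges weakly. Its moments converge
  too: after truncating \<open>x\<close> to \<open>[-R, R]\<close> the error in the \<open>k\<close>-th moment is at most
  the moment of order \<open>2 * k\<close> divided by \<open>R ^ k\<close>.\<close>

subsection \<open>Nonnegative real polynomials\<close>

lemma poly_map_of_real_add:
  fixes z :: complex
  shows "poly (map_poly of_real (p + q)) z = poly (map_poly of_real p) z + poly (map_poly of_real q) z"
proof -
  have "map_poly of_real (p + q) = map_poly of_real p + (map_poly of_real q :: complex poly)"
    by (intro poly_eqI) (simp add: coeff_map_poly)
  then show ?thesis by simp
qed

lemma poly_map_of_real_mult:
  fixes z :: complex
  shows "poly (map_poly of_real (p * q)) z = poly (map_poly of_real p) z * poly (map_poly of_real q) z"
proof -
  have smult: "poly (map_poly of_real (smult a p)) z = of_real a * poly (map_poly of_real p) z"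
    for a and p :: "real poly"
    by (induction p) (simp_all add: map_poly_pCons algebra_simps)
  show ?thesis
    by (induction p) (simp_all add: map_poly_pCons poly_map_of_real_add smult algebra_simps)
qed

lemma poly_map_of_real_of_real:
  "poly (map_poly of_real p) (complex_of_real x) = of_real (poly p x)"
  by (induction p) (simp_all add: map_poly_pCons)

text \<open>The quadratic is \<open>(X - z) * (X - cnj z)\<close>, written as a sum of two squares.
  Dividing \<open>p\<close> by it leaves a real remainder of degree below 2 that still vanishes at
  \<open>z\<close>, and a nonreal number is no root of a nonzero real polynomial of degree at most
  1.\<close>

lemma nonreal_root_quadratic_dvd:
  fixes p :: "real poly"
  assumes root: "poly (map_poly of_real p) z = 0" and "Im z \<noteq> 0"
  shows "[:- Re z, 1:]\<^sup>2 + [:Im z:]\<^sup>2 dvd p"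
proof -
  define w where "w = [:- Re z, 1:]\<^sup>2 + [:Im z:]\<^sup>2"
  have w: "w = [:(Re z)\<^sup>2 + (Im z)\<^sup>2, - 2 * Re z, 1:]"
    unfolding w_def by (simp add: power2_eq_square)
  have wz: "poly (map_poly of_real w) z = 0"
    unfolding w by (simp add: map_poly_pCons complex_eq_iff power2_eq_square algebra_simps)
  have "p = w * (p div w) + p mod w" by simp
  then have "poly (map_poly of_real p) z =
      poly (map_poly of_real w) z * poly (map_poly of_real (p div w)) z + poly (map_poly of_real (p mod w)) z"
    by (metis poly_map_of_real_add poly_map_of_real_mult)
  then have sz: "poly (map_poly of_real (p mod w)) z = 0"
    using root wz by simp
  have "degree (p mod w) < 2"
    using degree_mod_less[of w p] by (auto simp: w)
  then obtain a b where ab: "p mod w = [:a, b:]"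
    by (metis One_nat_def Suc_1 degree_pCons_eq_if not_less_eq pCons_cases degree_eq_zeroE less_Suc_eq less_nat_zero_code degree_0 pCons_0_0)
  \<comment> \<open>The imaginary part of \<open>a + b * z = 0\<close> reads
    \<open>b * Im z = 0\<close>.\<close>
  have "b = 0" "a = 0"
    using sz \<open>Im z \<noteq> 0\<close> unfolding ab by (auto simp: map_poly_pCons complex_eq_iff)
  then show ?thesis
    using ab unfolding w_def[symmetric] by (simp add: mod_eq_0_iff_dvd)
qed

lemma poly_nonneg_at_limit:
  fixes p :: "real poly"
  assumes "\<And>x. x \<noteq> a \<Longrightarrow> 0 \<le> poly p x"
  shows "0 \<le> poly p a"
proof (rule tendsto_lowerbound)
  show "(poly p \<longlongrightarrow> poly p a) (at a)"
    using poly_isCont[of a p] by (simp add: isCont_def)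
  show "\<forall>\<^sub>F x in at a. 0 \<le> poly p x"
    using assms by (simp add: eventually_at_filter)
qed simp

text \<open>The multiplicity of a real root is even: after one factor \<open>X - a\<close> is split
  off, the cofactor \<open>r\<close> has the sign of \<open>x - a\<close> on either side of
  \<open>a\<close>. By continuity it vanishes at \<open>a\<close> and yields the second
  factor.\<close>

lemma nonneg_poly_real_root:
  fixes p :: "real poly"
  assumes nonneg: "\<And>x. 0 \<le> poly p x" and root: "poly p a = 0"
  obtains q where "p = [:- a, 1:]\<^sup>2 * q" "\<And>x. 0 \<le> poly q x"
proof -
  obtain r where r: "p = [:- a, 1:] * r"
    using root by (metis poly_eq_0_iff_dvd dvdE)
  have pr: "0 \<le> (x - a) * poly r x" for x
    using nonneg[of x] by (simp add: r algebra_simps)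
  have lim: "(poly r \<longlongrightarrow> poly r a) (at a)"
    using poly_isCont[of a r] by (simp add: isCont_def)
  have "0 \<le> poly r a"
  proof (rule tendsto_lowerbound)
    show "(poly r \<longlongrightarrow> poly r a) (at_right a)"
      using lim by (rule filterlim_mono) (auto simp: at_le)
    show "\<forall>\<^sub>F x in at_right a. 0 \<le> poly r x"
      using pr by (auto simp: eventually_at_filter zero_le_mult_iff intro!: always_eventually)
         (smt (verit) zero_le_mult_iff)
  qed simp
  moreover have "poly r a \<le> 0"
  proof (rule tendsto_upperbound)
    show "(poly r \<longlongrightarrow> poly r a) (at_left a)"
      using lim by (rule filterlim_mono) (auto simp: at_le)
    show "\<forall>\<^sub>F x in at_left a. poly r x \<le> 0"
      using pr by (auto simp: eventually_at_filter intro!: always_eventually)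
         (smt (verit) zero_le_mult_iff)
  qed simp
  ultimately have "poly r a = 0" by simp
  then obtain q where q: "r = [:- a, 1:] * q"
    by (metis poly_eq_0_iff_dvd dvdE)
  have pq: "p = [:- a, 1:]\<^sup>2 * q"
    unfolding r q power2_eq_square by (rule mult.assoc[symmetric])
  have "0 \<le> poly q x" if "x \<noteq> a" for x
  proof -
    have "0 \<le> (x - a)\<^sup>2 * poly q x"
      using nonneg[of x] by (simp add: pq algebra_simps power2_eq_square)
    then show ?thesis using that by (simp add: zero_le_mult_iff)
  qed
  then have "0 \<le> poly q x" for x
    using poly_nonneg_at_limit[of a q] by (cases "x = a") auto
  with pq that show thesis by blast
qed

text \<open>A complex root of \<open>p\<close> provides a quadratic factor that is itself a sum of
  two squares, and the cofactor is again nonnegative but of smaller degree. Sums of two squares are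
  closed under products.\<close>

lemma nonneg_poly_sum_two_squares:
  fixes p :: "real poly"
  assumes "\<And>x. 0 \<le> poly p x"
  shows "\<exists>q r. p = q\<^sup>2 + r\<^sup>2"
  using assms
proof (induction "degree p" arbitrary: p rule: less_induct)
  case less
  have step: ?case
    if dec: "p = (u\<^sup>2 + v\<^sup>2) * t" and deg: "degree (u\<^sup>2 + v\<^sup>2) = 2"
      and t: "\<And>x. 0 \<le> poly t x" and "p \<noteq> 0" for u v t
  proof -
    have "degree p = 2 + degree t"
      using \<open>p \<noteq> 0\<close> deg unfolding dec by (subst degree_mult_eq) auto
    then obtain q r where "t = q\<^sup>2 + r\<^sup>2"
      using less.hyps[of t] t by auto
    \<comment> \<open>Brahmagupta-Fibonacci identity.\<close>
    then have "p = (u * q - v * r)\<^sup>2 + (u * r + v * q)\<^sup>2"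
      unfolding dec by (simp add: power2_eq_square algebra_simps)
    then show ?thesis by blast
  qed
  show ?case
  proof (cases "degree p = 0")
    case True
    then obtain c where c: "p = [:c:]" by (metis degree_eq_zeroE)
    then have "p = [:sqrt c:]\<^sup>2 + 0\<^sup>2"
      using less.prems[of 0] by (simp add: power2_eq_square)
    then show ?thesis by blast
  next
    case False
    then have "degree (map_poly of_real p :: complex poly) \<noteq> 0" "p \<noteq> 0"
      by (auto simp: degree_map_poly)
    then obtain z :: complex where z: "poly (map_poly of_real p) z = 0"
      using alg_closed_imp_poly_has_root[of "map_poly of_real p :: complex poly"] by auto
    show ?thesis
    proof (cases "Im z = 0")
      case True
      then have "z = of_real (Re z)" by (simp add: complex_eq_iff)
      with z have "poly p (Re z) = 0"
        by (metis of_real_0 of_real_eq_iff poly_map_of_real_of_real)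
      then obtain q where q: "p = [:- Re z, 1:]\<^sup>2 * q" "\<And>x. 0 \<le> poly q x"
        using nonneg_poly_real_root[of p "Re z"] less.prems by blast
      show ?thesis
        by (rule step[of "[:- Re z, 1:]" 0 q]) (use q \<open>p \<noteq> 0\<close> in \<open>auto simp: power2_eq_square\<close>)
    next
      case False
      from nonreal_root_quadratic_dvd[OF z False] obtain t
        where t: "p = ([:- Re z, 1:]\<^sup>2 + [:Im z:]\<^sup>2) * t" by (rule dvdE)
      have "0 \<le> poly t x" for x
      proof -
        have "0 \<le> ((x - Re z)\<^sup>2 + (Im z)\<^sup>2) * poly t x"
          using less.prems[of x] by (simp add: t algebra_simps power2_eq_square)
        moreover have "0 < (x - Re z)\<^sup>2 + (Im z)\<^sup>2"
          using False by (simp add: add_nonneg_pos)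
        ultimately show ?thesis by (simp add: zero_le_mult_iff)
      qed
      then show ?thesis
        by (intro step[of "[:- Re z, 1:]" "[:Im z:]" t]) (use t \<open>p \<noteq> 0\<close> in \<open>auto simp: power2_eq_square\<close>)
    qed
  qed
qed

subsection \<open>Moment sequences of finitely supported distributions\<close>

text \<open>The hyperplane passes through the point \<open>y\<close> nearest to \<open>m\<close>,
  with normal \<open>y - m\<close>. A sequence in \<open>C\<close> minimising the squared distance
  \<open>F\<close> is Cauchy in every coordinate from \<open>I\<close>; its limit \<open>y\<close>
  may lie outside \<open>C\<close>, so facts about \<open>y\<close> are first shown for the sequence
  and then passed to the limit.\<close>

lemma separate_from_convex:
  fixes C :: "('i \<Rightarrow> real) set" and m :: "'i \<Rightarrow> real" and I :: "'i set"
  assumes "C \<noteq> {}"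
    and conv: "\<And>x y s. x \<in> C \<Longrightarrow> y \<in> C \<Longrightarrow> 0 \<le> s \<Longrightarrow> s \<le> 1 \<Longrightarrow> (\<lambda>k. (1 - s) * x k + s * y k) \<in> C"
    and "0 < e" and far: "\<And>x. x \<in> C \<Longrightarrow> e \<le> (\<Sum>k\<in>I. (x k - m k)\<^sup>2)"
  obtains a b where "\<forall>x\<in>C. b \<le> (\<Sum>k\<in>I. a k * x k)" "(\<Sum>k\<in>I. a k * m k) < b"
proof -
  define F where "F x = (\<Sum>k\<in>I. (x k - m k)\<^sup>2)" for x
  define d where "d = Inf (F ` C)"
  have bdd: "bdd_below (F ` C)"
    using far by (intro bdd_belowI[of _ e]) (auto simp: F_def)
  have d_le: "d \<le> F x" if "x \<in> C" for x
    unfolding d_def using bdd that by (simp add: cInf_lower)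
  have "e \<le> d"
    unfolding d_def using \<open>C \<noteq> {}\<close> far by (intro cInf_greatest) (auto simp: F_def)
  have "\<exists>x\<in>C. F x < d + 1 / Suc i" for i
    using cInf_lessD[of "F ` C" "d + 1 / Suc i"] \<open>C \<noteq> {}\<close> unfolding d_def by auto
  then obtain x where xC: "\<And>i. x i \<in> C" and xF: "\<And>i. F (x i) < d + 1 / Suc i"
    by metis
  have inv0: "(\<lambda>i. 1 / Suc i) \<longlonglongrightarrow> (0::real)"
    using LIMSEQ_inverse_real_of_nat by (simp add: inverse_eq_divide)
  have Flim: "(\<lambda>i. F (x i)) \<longlonglongrightarrow> d"
  proof (rule tendsto_sandwich[where f = "\<lambda>i. d" and h = "\<lambda>i. d + 1 / Suc i"])
    show "(\<lambda>i. d + 1 / Suc i) \<longlonglongrightarrow> d"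
      using tendsto_add[OF tendsto_const inv0, of d] by simp
    show "(\<lambda>i. d) \<longlonglongrightarrow> d" by simp
    show "\<forall>\<^sub>F i in sequentially. d \<le> F (x i)"
      using d_le xC by simp
    show "\<forall>\<^sub>F i in sequentially. F (x i) \<le> d + 1 / Suc i"
      using xF by (intro always_eventually allI less_imp_le)
  qed
  \<comment> \<open>Parallelogram identity: the midpoint of two near-minimisers lies in \<open>C\<close>.\<close>
  have cauchy_sq: "(\<Sum>k\<in>I. (x i k - x j k)\<^sup>2) \<le> 2 / Suc i + 2 / Suc j" for i j
  proof -
    let ?z = "\<lambda>k. (1 - 1/2) * x i k + 1/2 * x j k"
    have "(\<Sum>k\<in>I. (x i k - x j k)\<^sup>2) = 2 * F (x i) + 2 * F (x j) - 4 * F ?z"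
      unfolding F_def sum_distrib_left sum.distrib[symmetric] sum_subtractf[symmetric]
      by (intro sum.cong) (auto simp: power2_eq_square field_simps)
    moreover have "d \<le> F ?z"
      by (rule d_le, rule conv) (auto simp: xC)
    ultimately show ?thesis using xF[of i] xF[of j] by simp
  qed
  have "convergent (\<lambda>i. x i k)" if "finite I" "k \<in> I" for k
  proof -
    have "(x i k - x j k)\<^sup>2 \<le> 2 / Suc i + 2 / Suc j" for i j
      using member_le_sum[OF \<open>k \<in> I\<close>, of "\<lambda>k. (x i k - x j k)\<^sup>2"] cauchy_sq[of i j] \<open>finite I\<close>
      by fastforce
    note sq = this
    have "Cauchy (\<lambda>i. x i k)"
    proof (rule CauchyI)
      fix r :: real assume "0 < r"
      then obtain N where N: "1 / Suc N < r\<^sup>2 / 4"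
        using nat_approx_posE[of "r\<^sup>2 / 4"] by auto
      have "norm (x i k - x j k) < r" if "N \<le> i" "N \<le> j" for i j
      proof -
        have "1 / Suc i \<le> (1 / Suc N :: real)" "1 / Suc j \<le> (1 / Suc N :: real)"
          using that by (auto intro!: divide_left_mono)
        then have "(x i k - x j k)\<^sup>2 < r\<^sup>2"
          using sq[of i j] N by simp
        then show ?thesis
          using \<open>0 < r\<close> by (metis abs_of_pos power2_less_imp_less power2_abs abs_ge_zero real_norm_def less_imp_le)
      qed
      then show "\<exists>M. \<forall>m\<ge>M. \<forall>n\<ge>M. norm (x m k - x n k) < r" by blast
    qed
    then show ?thesis by (simp add: Cauchy_convergent_iff)
  qed
  \<comment> \<open>A sum over an infinite set is 0 by convention, which would contradict the
    positive lower bound \<open>e\<close>.\<close>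
  moreover have "finite I"
  proof (rule ccontr)
    assume "infinite I"
    then have "F (x 0) = 0" by (simp add: F_def)
    then show False using far[OF xC[of 0]] \<open>0 < e\<close> by (simp add: F_def)
  qed
  ultimately have "\<exists>y. \<forall>k\<in>I. (\<lambda>i. x i k) \<longlonglongrightarrow> y k"
    by (intro bchoice) (auto simp: convergent_def)
  then obtain y where y: "\<And>k. k \<in> I \<Longrightarrow> (\<lambda>i. x i k) \<longlonglongrightarrow> y k" by blast
  have Fy: "F y = d"
    using Flim unfolding F_def
    by (rule LIMSEQ_unique[rotated]) (intro tendsto_intros y)
  have nonneg: "0 \<le> (\<Sum>k\<in>I. (y k - m k) * (z k - y k))" if "z \<in> C" for z
  proof -
    \<comment> \<open>First-order condition at the minimum: on the segment from \<open>y\<close> to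
      \<open>z\<close>, \<open>F\<close> equals \<open>d + 2 * s * A + s^2 * B\<close> and does not
      drop below \<open>d\<close>. Dividing by \<open>s\<close> and letting \<open>s\<close> tend to
      0 from the right gives \<open>A \<ge> 0\<close>.\<close>
    define A B where "A = (\<Sum>k\<in>I. (y k - m k) * (z k - y k))" and "B = (\<Sum>k\<in>I. (z k - y k)\<^sup>2)"
    have "0 \<le> 2 * s * A + s\<^sup>2 * B" if "0 \<le> s" "s \<le> 1" for s
    proof -
      have "d \<le> F (\<lambda>k. (1 - s) * x i k + s * z k)" for i
        using that by (intro d_le conv xC \<open>z \<in> C\<close>)
      moreover have "(\<lambda>i. F (\<lambda>k. (1 - s) * x i k + s * z k)) \<longlonglongrightarrow> F (\<lambda>k. (1 - s) * y k + s * z k)"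
        unfolding F_def by (intro tendsto_intros y)
      ultimately have "d \<le> F (\<lambda>k. (1 - s) * y k + s * z k)"
        by (meson LIMSEQ_le_const)
      also have "\<dots> = F y + 2 * s * A + s\<^sup>2 * B"
        unfolding F_def A_def B_def sum_distrib_left sum.distrib[symmetric]
        by (intro sum.cong) (auto simp: power2_eq_square field_simps)
      finally show ?thesis using Fy by simp
    qed
    note quad = this
    have "0 \<le> 2 * A + s * B" if "0 < s" "s \<le> 1" for s
    proof -
      have "0 \<le> s * (2 * A + s * B)"
        using quad[of s] that by (simp add: power2_eq_square algebra_simps)
      then show ?thesis using that by (simp add: zero_le_mult_iff)
    qed
    then have ev: "\<forall>\<^sub>F s in at_right 0. 0 \<le> 2 * A + s * B"
      unfolding eventually_at_right_field by (intro exI[of _ 1]) auto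
    have "((\<lambda>s. 2 * A + s * B) \<longlongrightarrow> 2 * A + 0 * B) (at_right 0)"
      by (intro tendsto_intros)
    from tendsto_lowerbound[OF this ev] show ?thesis by (simp add: A_def)
  qed
  show thesis
  proof (rule that[of "\<Sum>k\<in>I. (y k - m k) * y k" "\<lambda>k. y k - m k"])
    show "\<forall>z\<in>C. (\<Sum>k\<in>I. (y k - m k) * y k) \<le> (\<Sum>k\<in>I. (y k - m k) * z k)"
      using nonneg by (simp add: right_diff_distrib sum_subtractf)
    \<comment> \<open>The gap between the two sides is exactly the minimal squared distance, at
      least \<open>e > 0\<close>.\<close>
    have "(\<Sum>k\<in>I. (y k - m k) * y k) - (\<Sum>k\<in>I. (y k - m k) * m k) = d"
      unfolding Fy[symmetric] F_def sum_subtractf[symmetric]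
      by (intro sum.cong) (auto simp: power2_eq_square algebra_simps)
    then show "(\<Sum>k\<in>I. (y k - m k) * m k) < (\<Sum>k\<in>I. (y k - m k) * y k)"
      using \<open>e \<le> d\<close> \<open>0 < e\<close> by simp
  qed
qed

section \<open>The Riesz functional of a moment sequence\<close>

definition moment_functional :: "(nat \<Rightarrow> real) \<Rightarrow> real poly \<Rightarrow> real" where
  "moment_functional m p = (\<Sum>k\<le>degree p. coeff p k * m k)"

text \<open>Lets polynomials of different degrees share one summation range, as additivity
  requires.\<close>

lemma moment_functional_altdef:
  assumes "degree p \<le> n"
  shows "moment_functional m p = (\<Sum>k\<le>n. coeff p k * m k)"
  unfolding moment_functional_def
  by (rule sum.mono_neutral_left) (use assms in \<open>auto simp: coeff_eq_0\<close>)

lemma moment_functional_add: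
  "moment_functional m (p + q) = moment_functional m p + moment_functional m q"
proof -
  define n where "n = max (degree p) (degree q)"
  have "degree p \<le> n" "degree q \<le> n" "degree (p + q) \<le> n"
    by (auto simp: n_def degree_add_le)
  then show ?thesis
    by (simp add: moment_functional_altdef[of _ n] sum.distrib ring_distribs)
qed

lemma moment_functional_sum:
  "moment_functional m (\<Sum>i\<in>I. f i) = (\<Sum>i\<in>I. moment_functional m (f i))"
  by (induction I rule: infinite_finite_induct)
     (simp_all add: moment_functional_add moment_functional_altdef[of 0 0])

lemma moment_functional_monom: "moment_functional m (monom c n) = c * m n"
proof -
  have "moment_functional m (monom c n) = (\<Sum>k\<le>n. coeff (monom c n) k * m k)"
    by (rule moment_functional_altdef) (rule degree_monom_le)
  also have "\<dots> = (\<Sum>k\<le>n. if k = n then c * m n else 0)"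
    by (intro sum.cong) auto
  finally show ?thesis by simp
qed

lemma moment_functional_power2:
  "moment_functional m (p\<^sup>2) = (\<Sum>j\<le>degree p. \<Sum>k\<le>degree p. coeff p j * coeff p k * m (j + k))"
proof -
  have "p\<^sup>2 = (\<Sum>j\<le>degree p. \<Sum>k\<le>degree p. monom (coeff p j * coeff p k) (j + k))"
    unfolding power2_eq_square
    by (subst (1 2) poly_as_sum_of_monoms[symmetric]) (simp add: sum_product mult_monom)
  then show ?thesis
    by (simp add: moment_functional_sum moment_functional_monom)
qed

text \<open>The value at \<open>p\<^sup>2\<close> is the Hankel quadratic form at the coefficient
  vector of \<open>p\<close>, which serves as the test sequence \<open>c\<close>.\<close>

lemma pos_semidef_moment_functional_power2:
  assumes "pos_semidef (\<lambda>j k. m (j + k))"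
  shows "0 \<le> moment_functional m (p\<^sup>2)"
proof -
  define c where "c k = complex_of_real (coeff p k)" for k
  define S where "S = {k. c k \<noteq> 0}"
  have S: "S \<subseteq> {..degree p}"
    by (auto simp: S_def c_def le_degree)
  have "0 \<le> (\<Sum>j\<in>S. \<Sum>k\<in>S. cnj (c j) * complex_of_real (m (j + k)) * c k)"
    using assms finite_subset[OF S] unfolding pos_semidef_def S_def by blast
  also have "\<dots> = of_real (\<Sum>j\<in>S. \<Sum>k\<in>S. coeff p j * coeff p k * m (j + k))"
    unfolding of_real_sum by (intro sum.cong) (simp_all add: c_def)
  \<comment> \<open>Positive semidefiniteness sums over the support of \<open>c\<close> only. Both
    ranges are extended to all indices up to the degree, where the added coefficients
    vanish.\<close>
  also have "(\<Sum>j\<in>S. \<Sum>k\<in>S. coeff p j * coeff p k * m (j + k)) =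
      (\<Sum>j\<le>degree p. \<Sum>k\<in>S. coeff p j * coeff p k * m (j + k))"
    by (rule sum.mono_neutral_left) (use S in \<open>auto simp: S_def c_def\<close>)
  also have "\<dots> = (\<Sum>j\<le>degree p. \<Sum>k\<le>degree p. coeff p j * coeff p k * m (j + k))"
    by (intro sum.cong refl sum.mono_neutral_left) (use S in \<open>auto simp: S_def c_def\<close>)
  finally show ?thesis
    by (simp add: moment_functional_power2 less_eq_complex_def)
qed

text \<open>Convex combinations of moment sequences are realised by tossing a coin that selects
  \<open>q\<close> with probability \<open>s\<close>.\<close>

lemma mixture_pmf_expectation:
  fixes f :: "'a \<Rightarrow> real"
  assumes "finite (set_pmf p)" "finite (set_pmf q)" "0 \<le> s" "s \<le> 1"
  shows "measure_pmf.expectation (bind_pmf (bernoulli_pmf s) (\<lambda>b. if b then q else p)) f =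
    (1 - s) * measure_pmf.expectation p f + s * measure_pmf.expectation q f"
  by (subst pmf_expectation_bind[of UNIV]) (use assms in \<open>auto simp: UNIV_bool\<close>)

lemma approximate_moments_by_pmf:
  fixes m :: "nat \<Rightarrow> real"
  assumes pos: "\<And>p. 0 \<le> moment_functional m (p\<^sup>2)" and "m 0 = 1" and "0 < e"
  shows "\<exists>p :: real pmf. finite (set_pmf p) \<and>
    (\<Sum>k<n. (measure_pmf.expectation p (\<lambda>t. t ^ k) - m k)\<^sup>2) < e"
proof (rule ccontr)
  assume none: "\<not> ?thesis"
  define C where "C = {\<lambda>k. measure_pmf.expectation p (\<lambda>t. t ^ k) |p :: real pmf. finite (set_pmf p)}"
  have far: "e \<le> (\<Sum>k<n. (x k - m k)\<^sup>2)" if x: "x \<in> C" for x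
  proof -
    obtain p :: "real pmf" where p: "finite (set_pmf p)" "x = (\<lambda>k. measure_pmf.expectation p (\<lambda>t. t ^ k))"
      using x unfolding C_def by blast
    then have "\<not> (\<Sum>k<n. (x k - m k)\<^sup>2) < e"
      using none by blast
    then show ?thesis by simp
  qed
  have dirac: "(\<lambda>k. t ^ k) \<in> C" for t
    unfolding C_def by (intro CollectI exI[of _ "return_pmf t"]) simp
  have conv: "(\<lambda>k. (1 - s) * x k + s * y k) \<in> C"
    if xy: "x \<in> C" "y \<in> C" and s: "0 \<le> s" "s \<le> 1" for x y s
  proof -
    obtain p q where "finite (set_pmf p)" "x = (\<lambda>k. measure_pmf.expectation p (\<lambda>t. t ^ k))"
      "finite (set_pmf q)" "y = (\<lambda>k. measure_pmf.expectation q (\<lambda>t. t ^ k))"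
      using xy unfolding C_def by blast
    then show ?thesis
      unfolding C_def using s
      by (intro CollectI exI[of _ "bind_pmf (bernoulli_pmf s) (\<lambda>b. if b then q else p)"])
         (simp add: mixture_pmf_expectation)
  qed
  obtain a b where ab: "\<forall>x\<in>C. b \<le> (\<Sum>k<n. a k * x k)" "(\<Sum>k<n. a k * m k) < b"
  proof (rule separate_from_convex[where C = C and e = e and I = "{..<n}" and m = m])
    show "C \<noteq> {}" using dirac by blast
  qed (rule conv far \<open>0 < e\<close> that; assumption)+
  \<comment> \<open>Tested on the point mass at \<open>t\<close>, the separating inequality says
    exactly that \<open>P\<close> is nonnegative at \<open>t\<close>.\<close>
  define P where "P = (\<Sum>k<n. monom (a k) k) + monom (- b) 0"
  have "0 \<le> poly P t" for t
    using bspec[OF ab(1) dirac[of t]] by (simp add: P_def poly_sum poly_monom)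
  then obtain q r where "P = q\<^sup>2 + r\<^sup>2"
    using nonneg_poly_sum_two_squares by blast
  then have "0 \<le> moment_functional m P"
    using pos by (simp add: moment_functional_add)
  \<comment> \<open>The constant term contributes \<open>- b\<close> because
    \<open>m 0 = 1\<close>.\<close>
  also have "moment_functional m P = (\<Sum>k<n. a k * m k) - b"
    by (simp add: P_def moment_functional_add moment_functional_sum moment_functional_monom \<open>m 0 = 1\<close>)
  finally show False using ab(2) by simp
qed

subsection \<open>Moments of weak limits\<close>

text \<open>Chebyshev's inequality bounds the mass outside the interval from \<open>- R\<close> to
  \<open>R\<close> by \<open>B / R\<^sup>2\<close>, uniformly in \<open>i\<close>.\<close>

lemma tight_of_bounded_second_moments:
  fixes \<mu> :: "nat \<Rightarrow> real measure"
  assumes \<mu>: "\<And>i. real_distribution (\<mu> i)"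
    and int: "\<And>i. integrable (\<mu> i) (\<lambda>x. x\<^sup>2)"
    and bound: "\<And>i. (\<integral>x. x\<^sup>2 \<partial>\<mu> i) \<le> B"
  shows "tight \<mu>"
  unfolding tight_def
proof (intro conjI allI impI)
  fix e :: real assume "0 < e"
  \<comment> \<open>Makes \<open>B / R\<^sup>2 = e * B / (\<bar>B\<bar> + 1)\<close>; the summand 1
    keeps \<open>R\<close> positive and the final inequality strict.\<close>
  define R where "R = sqrt ((\<bar>B\<bar> + 1) / e)"
  have R2: "R\<^sup>2 = (\<bar>B\<bar> + 1) / e" and "0 < R"
    using \<open>0 < e\<close> by (auto simp: R_def)
  have "1 - e < measure (\<mu> i) {- R<..R}" for i
  proof -
    interpret real_distribution "\<mu> i" by (rule \<mu>)
    have sp: "space (\<mu> i) = UNIV" using sets_eq_imp_space_eq[OF events_eq_borel] by simp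
    have "1 - measure (\<mu> i) {- R<..R} = measure (\<mu> i) (UNIV - {- R<..R})"
      using prob_compl[of "{- R<..R}"] by (simp add: sp)
    also have "\<dots> \<le> measure (\<mu> i) {x \<in> space (\<mu> i). R\<^sup>2 \<le> x\<^sup>2}"
    proof (rule finite_measure_mono)
      show "UNIV - {- R<..R} \<subseteq> {x \<in> space (\<mu> i). R\<^sup>2 \<le> x\<^sup>2}"
        using \<open>0 < R\<close> by (auto simp: sp abs_le_square_iff[symmetric])
    qed measurable
    also have "\<dots> \<le> (\<integral>x. x\<^sup>2 \<partial>\<mu> i) / R\<^sup>2"
      by (rule integral_Markov_inequality_measure[OF int, of "{}"]) (use \<open>0 < R\<close> in auto)
    also have "\<dots> \<le> B / R\<^sup>2"
      using bound by (intro divide_right_mono) auto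
    also have "\<dots> < e"
    proof -
      have "B * e < e * (\<bar>B\<bar> + 1)"
        using mult_strict_right_mono[of B "\<bar>B\<bar> + 1" e] \<open>0 < e\<close> by (simp only: mult.commute[of e])
      then have "B * e / (\<bar>B\<bar> + 1) < e"
        by (subst pos_divide_less_eq) auto
      then show ?thesis
        unfolding R2 by simp
    qed
    finally show ?thesis by simp
  qed
  then show "\<exists>a b. a < b \<and> (\<forall>i. 1 - e < measure (\<mu> i) {a<..b})"
    using \<open>0 < R\<close> by (intro exI[of _ "- R"] exI[of _ R]) auto
qed (rule \<mu>)

section \<open>Truncation to a bounded interval\<close>

definition clamp_real :: "real \<Rightarrow> real \<Rightarrow> real" where
  "clamp_real R x = max (- R) (min R x)"

lemma continuous_clamp_real: "continuous_on UNIV (clamp_real R)"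
  unfolding clamp_real_def[abs_def] by (intro continuous_intros)

lemma borel_measurable_clamp_real [measurable]: "clamp_real R \<in> borel_measurable borel"
  by (rule borel_measurable_continuous_onI[OF continuous_clamp_real])

lemma abs_clamp_real_power_le:
  assumes "0 \<le> R"
  shows "\<bar>clamp_real R x ^ k\<bar> \<le> R ^ k" and "\<bar>clamp_real R x ^ k\<bar> \<le> \<bar>x\<bar> ^ k"
  unfolding power_abs by (rule power_mono; use assms in \<open>auto simp: clamp_real_def\<close>)+

text \<open>The error is zero for \<open>\<bar>x\<bar> \<le> R\<close>. Beyond that it is at most
  \<open>\<bar>x\<bar> ^ k\<close>, and the extra factor
  \<open>(\<bar>x\<bar> / R) ^ k \<ge> 1\<close> buys decay in \<open>R\<close> at the price of a
  higher even moment.\<close>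

lemma clamp_real_power_error:
  assumes "0 < R"
  shows "\<bar>x ^ k - clamp_real R x ^ k\<bar> \<le> x ^ (2 * k) / R ^ k"
proof (cases "\<bar>x\<bar> \<le> R")
  case True
  then show ?thesis
    using assms by (simp add: clamp_real_def power_mult)
next
  case False
  have *: "\<bar>t ^ k - R ^ k\<bar> \<le> t ^ (2 * k) / R ^ k" if "R < t" for t
  proof -
    have "R ^ k \<le> t ^ k" using that assms by (intro power_mono) auto
    moreover have "t ^ k * R ^ k \<le> t ^ k * t ^ k"
      using calculation that assms by (intro mult_left_mono) auto
    then have "t ^ k \<le> t ^ (2 * k) / R ^ k"
      using assms by (simp add: field_simps mult_2_right power_add)
    moreover have "0 < R ^ k" using assms by simp
    ultimately show ?thesis by linarith
  qed
  show ?thesis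
  proof (cases "0 < x")
    case True
    then show ?thesis using *[of x] False assms by (simp add: clamp_real_def)
  next
    case neg: False
    then have "clamp_real R x = - R" using False assms by (simp add: clamp_real_def)
    \<comment> \<open>Replacing \<open>x\<close> and \<open>- R\<close> by their negatives changes
      the difference at most by a sign, according to the parity of \<open>k\<close>.\<close>
    moreover have "\<bar>x ^ k - (- R) ^ k\<bar> = \<bar>(- x) ^ k - R ^ k\<bar>"
      by (cases "even k") (simp_all add: abs_minus_commute)
    ultimately show ?thesis using *[of "- x"] neg False by simp
  qed
qed

text \<open>Weak convergence speaks about bounded continuous integrands; truncated powers are such,
  while \<open>x ^ k\<close> is unbounded for \<open>k > 0\<close>.\<close>

lemma weak_conv_clamp_real_power:
  assumes "\<And>i. real_distribution (\<mu> i)" "real_distribution \<nu>" "weak_conv_m \<mu> \<nu>" "0 \<le> R"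
  shows "(\<lambda>i. \<integral>x. clamp_real R x ^ k \<partial>\<mu> i) \<longlonglongrightarrow> (\<integral>x. clamp_real R x ^ k \<partial>\<nu>)"
proof (rule weak_conv_imp_integral_bdd_continuous_conv[OF assms(1-3), where B = "R ^ k"])
  show "isCont (\<lambda>x. clamp_real R x ^ k) x" for x
    using continuous_on_eq_continuous_at[of UNIV "clamp_real R"] continuous_clamp_real
    by (intro continuous_intros) auto
qed (use abs_clamp_real_power_le[OF \<open>0 \<le> R\<close>] in auto)

lemma (in real_distribution) integrable_clamp_real_power:
  assumes "0 \<le> R"
  shows "integrable M (\<lambda>x. clamp_real R x ^ k)"
  by (rule integrable_const_bound[of _ "R ^ k"]) (use abs_clamp_real_power_le[OF assms] in auto)

text \<open>Truncated even powers lie below the full ones, so weak convergence bounds their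
  integrals under \<open>\<nu>\<close> by \<open>c\<close>. Fatou's lemma removes the truncation as
  \<open>R\<close> runs through the naturals.\<close>

lemma weak_limit_even_moment_bound:
  assumes \<mu>: "\<And>i. real_distribution (\<mu> i)" and \<nu>: "real_distribution \<nu>" and wc: "weak_conv_m \<mu> \<nu>"
    and int: "\<And>i. integrable (\<mu> i) (\<lambda>x. x ^ (2 * k))"
    and lim: "(\<lambda>i. \<integral>x. x ^ (2 * k) \<partial>\<mu> i) \<longlonglongrightarrow> c"
  shows "integrable \<nu> (\<lambda>x. x ^ (2 * k))" and "(\<integral>x. x ^ (2 * k) \<partial>\<nu>) \<le> c"
proof -
  interpret \<nu>: real_distribution \<nu> by fact
  have even: "0 \<le> clamp_real R x ^ (2 * k)" for R x
    by (simp add: power_mult)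
  have le: "(\<integral>x. clamp_real R x ^ (2 * k) \<partial>\<nu>) \<le> c" if "0 \<le> R" for R
  proof (rule LIMSEQ_le[OF weak_conv_clamp_real_power[OF \<mu> \<nu> wc that] lim])
    have "(\<integral>x. clamp_real R x ^ (2 * k) \<partial>\<mu> i) \<le> (\<integral>x. x ^ (2 * k) \<partial>\<mu> i)" for i
    proof (rule integral_mono[OF real_distribution.integrable_clamp_real_power[OF \<mu> that] int])
      show "clamp_real R x ^ (2 * k) \<le> x ^ (2 * k)" for x
        using abs_clamp_real_power_le(2)[OF that, of x "2 * k"] by (simp add: power_mult)
    qed
    then show "\<exists>N. \<forall>i\<ge>N. (\<integral>x. clamp_real R x ^ (2 * k) \<partial>\<mu> i) \<le> (\<integral>x. x ^ (2 * k) \<partial>\<mu> i)"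
      by blast
  qed
  \<comment> \<open>Since \<open>ennreal\<close> sends negative numbers to 0, this is what permits
    the return from \<open>ennreal c\<close> to the real bound at the end.\<close>
  have "0 \<le> c"
    using le[of 0] by (rule order_trans[rotated]) (auto intro!: integral_nonneg_AE simp: power_mult)
  have "(\<lambda>i. ennreal (clamp_real (real i) x ^ (2 * k))) \<longlonglongrightarrow> ennreal (x ^ (2 * k))" for x
  proof (rule tendsto_eventually)
    obtain N where "\<bar>x\<bar> \<le> real N" using real_arch_simple by blast
    then have "clamp_real (real i) x = x" if "N \<le> i" for i
      using that by (auto simp: clamp_real_def)
    then show "\<forall>\<^sub>F i in sequentially. ennreal (clamp_real (real i) x ^ (2 * k)) = ennreal (x ^ (2 * k))"
      unfolding eventually_sequentially by (intro exI[of _ N]) auto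
  qed
  then have "liminf (\<lambda>i. ennreal (clamp_real (real i) x ^ (2 * k))) = ennreal (x ^ (2 * k))" for x
    by (intro lim_imp_Liminf) auto
  then have "(\<integral>\<^sup>+x. ennreal (x ^ (2 * k)) \<partial>\<nu>) =
      (\<integral>\<^sup>+x. liminf (\<lambda>i. ennreal (clamp_real (real i) x ^ (2 * k))) \<partial>\<nu>)"
    by simp
  also have "\<dots> \<le> liminf (\<lambda>i. \<integral>\<^sup>+x. ennreal (clamp_real (real i) x ^ (2 * k)) \<partial>\<nu>)"
    by (rule nn_integral_liminf) measurable
  also have "\<dots> \<le> liminf (\<lambda>i::nat. ennreal c)"
  proof (intro Liminf_mono always_eventually allI)
    fix i :: nat
    have "(\<integral>\<^sup>+x. ennreal (clamp_real (real i) x ^ (2 * k)) \<partial>\<nu>) = ennreal (\<integral>x. clamp_real (real i) x ^ (2 * k) \<partial>\<nu>)"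
      by (intro nn_integral_eq_integral \<nu>.integrable_clamp_real_power) (auto simp: even)
    also have "\<dots> \<le> ennreal c"
      using le by (intro ennreal_leI) auto
    finally show "(\<integral>\<^sup>+x. ennreal (clamp_real (real i) x ^ (2 * k)) \<partial>\<nu>) \<le> ennreal c" .
  qed
  finally have nn: "(\<integral>\<^sup>+x. ennreal (x ^ (2 * k)) \<partial>\<nu>) \<le> ennreal c"
    by (simp add: Liminf_const)
  show int\<nu>: "integrable \<nu> (\<lambda>x. x ^ (2 * k))"
  proof (rule integrableI_bounded)
    show "(\<integral>\<^sup>+x. ennreal (norm (x ^ (2 * k))) \<partial>\<nu>) < \<infinity>"
      using nn by (simp add: power_mult le_less_trans[OF _ ennreal_less_top])
  qed simp
  then have "ennreal (\<integral>x. x ^ (2 * k) \<partial>\<nu>) \<le> ennreal c"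
    using nn by (subst nn_integral_eq_integral[symmetric]) (auto simp: power_mult)
  then show "(\<integral>x. x ^ (2 * k) \<partial>\<nu>) \<le> c"
    using \<open>0 \<le> c\<close> by (simp add: ennreal_le_iff)
qed

text \<open>Domination by \<open>\<bar>t\<bar> \<le> 1 + t\<^sup>2\<close> at
  \<open>t = x ^ k\<close>.\<close>

lemma (in real_distribution) integrable_power_of_even:
  assumes "integrable M (\<lambda>x. x ^ (2 * k))"
  shows "integrable M (\<lambda>x. x ^ k)"
proof (rule Bochner_Integration.integrable_bound)
  show "integrable M (\<lambda>x. 1 + x ^ (2 * k))"
    using assms by simp
  have "\<bar>t\<bar> \<le> 1 + t\<^sup>2" for t :: real
    using sum_squares_bound[of "\<bar>t\<bar>" 1] by (simp add: power2_eq_square)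
  then show "AE x in M. norm (x ^ k) \<le> norm (1 + x ^ (2 * k))"
    by (simp add: mult.commute power_mult abs_of_pos add_pos_nonneg)
qed simp

lemma (in real_distribution) clamp_real_moment_error:
  assumes "integrable M (\<lambda>x. x ^ (2 * k))" "0 < R"
  shows "\<bar>(\<integral>x. x ^ k \<partial>M) - (\<integral>x. clamp_real R x ^ k \<partial>M)\<bar> \<le> (\<integral>x. x ^ (2 * k) \<partial>M) / R ^ k"
proof -
  note int = integrable_power_of_even[OF assms(1)] integrable_clamp_real_power[of R k]
  have "\<bar>(\<integral>x. x ^ k \<partial>M) - (\<integral>x. clamp_real R x ^ k \<partial>M)\<bar> = \<bar>\<integral>x. x ^ k - clamp_real R x ^ k \<partial>M\<bar>"
    using int assms by (subst Bochner_Integration.integral_diff) auto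
  also have "\<dots> \<le> (\<integral>x. \<bar>x ^ k - clamp_real R x ^ k\<bar> \<partial>M)"
    by (rule integral_abs_bound)
  also have "\<dots> \<le> (\<integral>x. x ^ (2 * k) / R ^ k \<partial>M)"
    using int assms clamp_real_power_error[OF assms(2)] by (intro integral_mono) auto
  finally show ?thesis by simp
qed

lemma moments_of_weak_limit:
  assumes \<mu>: "\<And>i. real_distribution (\<mu> i)" and \<nu>: "real_distribution \<nu>" and wc: "weak_conv_m \<mu> \<nu>"
    and int: "\<And>i. integrable (\<mu> i) (\<lambda>x. x ^ (2 * k))"
    and lim_even: "(\<lambda>i. \<integral>x. x ^ (2 * k) \<partial>\<mu> i) \<longlonglongrightarrow> c"
    and lim: "(\<lambda>i. \<integral>x. x ^ k \<partial>\<mu> i) \<longlonglongrightarrow> m"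
  shows "(\<integral>x. x ^ k \<partial>\<nu>) = m"
proof (cases "k = 0")
  \<comment> \<open>The error bound below does not decay in \<open>R\<close> when
    \<open>k = 0\<close>; here the moments are total masses.\<close>
  case True
  have "prob_space (\<mu> i)" "prob_space \<nu>" for i
    using \<mu> \<nu> by (auto simp: real_distribution_def)
  then show ?thesis
    using lim True by (simp add: prob_space.prob_space LIMSEQ_const_iff)
next
  case False
  note \<nu>_even = weak_limit_even_moment_bound[OF \<mu> \<nu> wc int lim_even]
  \<comment> \<open>Both \<open>m\<close> and the moment of \<open>\<nu>\<close> are within
    \<open>c / R ^ k\<close> of the truncated moment of \<open>\<nu>\<close>: the former as a limit
    of the errors for \<open>\<mu> i\<close>, the latter through the bound on the even moment of
    \<open>\<nu>\<close>.\<close>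
  have err: "\<bar>(\<integral>x. x ^ k \<partial>\<nu>) - m\<bar> \<le> 2 * c / R ^ k" if "0 < R" for R
  proof -
    have "\<bar>m - (\<integral>x. clamp_real R x ^ k \<partial>\<nu>)\<bar> \<le> c / R ^ k"
    proof (rule LIMSEQ_le)
      show "(\<lambda>i. \<bar>(\<integral>x. x ^ k \<partial>\<mu> i) - (\<integral>x. clamp_real R x ^ k \<partial>\<mu> i)\<bar>)
          \<longlonglongrightarrow> \<bar>m - (\<integral>x. clamp_real R x ^ k \<partial>\<nu>)\<bar>"
        using that by (intro tendsto_intros lim weak_conv_clamp_real_power[OF \<mu> \<nu> wc]) auto
      show "(\<lambda>i. (\<integral>x. x ^ (2 * k) \<partial>\<mu> i) / R ^ k) \<longlonglongrightarrow> c / R ^ k"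
        using that by (intro tendsto_intros lim_even) auto
      show "\<exists>N. \<forall>i\<ge>N. \<bar>(\<integral>x. x ^ k \<partial>\<mu> i) - (\<integral>x. clamp_real R x ^ k \<partial>\<mu> i)\<bar> \<le> (\<integral>x. x ^ (2 * k) \<partial>\<mu> i) / R ^ k"
        using real_distribution.clamp_real_moment_error[OF \<mu> int that] by blast
    qed
    moreover have "\<bar>(\<integral>x. x ^ k \<partial>\<nu>) - (\<integral>x. clamp_real R x ^ k \<partial>\<nu>)\<bar> \<le> (\<integral>x. x ^ (2 * k) \<partial>\<nu>) / R ^ k"
      by (rule real_distribution.clamp_real_moment_error[OF \<nu> \<nu>_even(1) that])
    moreover have "(\<integral>x. x ^ (2 * k) \<partial>\<nu>) / R ^ k \<le> c / R ^ k"
      using \<nu>_even(2) that by (intro divide_right_mono) auto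
    ultimately show ?thesis by (simp add: add_divide_distrib)
  qed
  have "\<bar>(\<integral>x. x ^ k \<partial>\<nu>) - m\<bar> \<le> 0"
  proof (rule tendsto_lowerbound)
    show "((\<lambda>R. 2 * c / R ^ k) \<longlongrightarrow> 0) at_top"
      using False by (intro tendsto_divide_0[OF tendsto_const] filterlim_at_top_imp_at_infinity
        filterlim_pow_at_top filterlim_ident) auto
    show "\<forall>\<^sub>F R in at_top. \<bar>(\<integral>x. x ^ k \<partial>\<nu>) - m\<bar> \<le> 2 * c / R ^ k"
      using eventually_gt_at_top[of 0] by (rule eventually_mono) (rule err)
  qed simp
  then show ?thesis by simp
qed

section \<open>The Hamburger moment problem\<close>

theorem hamburger_moment_problem:
  fixes m :: "nat \<Rightarrow> real"
  assumes pos: "\<And>p. 0 \<le> moment_functional m (p\<^sup>2)" and "m 0 = 1"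
  shows "\<exists>\<nu>. real_distribution \<nu> \<and> (\<forall>k. integrable \<nu> (\<lambda>x. x ^ k) \<and> (\<integral>x. x ^ k \<partial>\<nu>) = m k)"
proof -
  \<comment> \<open>The number of matched moments and the accuracy grow together, so every fixed
    moment converges. The tolerance is squared because it bounds a sum of squares.\<close>
  have "\<exists>p :: real pmf. finite (set_pmf p) \<and>
      (\<Sum>k<N. (measure_pmf.expectation p (\<lambda>t. t ^ k) - m k)\<^sup>2) < (1 / Suc N)\<^sup>2" for N
    by (rule approximate_moments_by_pmf) (use assms in auto)
  then obtain p :: "nat \<Rightarrow> real pmf" where fin: "\<And>N. finite (set_pmf (p N))"
    and approx: "\<And>N. (\<Sum>k<N. (measure_pmf.expectation (p N) (\<lambda>t. t ^ k) - m k)\<^sup>2) < (1 / Suc N)\<^sup>2"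
    by metis
  have inv0: "(\<lambda>i. 1 / Suc i) \<longlonglongrightarrow> (0::real)"
    using LIMSEQ_inverse_real_of_nat by (simp add: inverse_eq_divide)
  \<comment> \<open>On a \<open>pmf\<close> every set is measurable; the push-forward along the
    identity restricts it to the Borel sets, as \<open>real_distribution\<close> demands.\<close>
  define \<mu> where "\<mu> N = distr (measure_pmf (p N)) borel (\<lambda>x. x)" for N
  have \<mu>: "real_distribution (\<mu> N)" for N
    unfolding \<mu>_def by (rule prob_space.real_distribution_distr[OF prob_space_measure_pmf]) simp
  have int: "integrable (\<mu> N) (\<lambda>x. x ^ k)" for N k
    unfolding \<mu>_def by (subst integrable_distr_eq) (auto intro!: integrable_measure_pmf_finite fin)
  have \<mu>_eq: "(\<integral>x. x ^ k \<partial>\<mu> N) = measure_pmf.expectation (p N) (\<lambda>t. t ^ k)" for N k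
    unfolding \<mu>_def by (subst integral_distr) auto
  have close: "\<bar>(\<integral>x. x ^ k \<partial>\<mu> N) - m k\<bar> < 1 / Suc N" if "k < N" for k N
  proof -
    have "((\<integral>x. x ^ k \<partial>\<mu> N) - m k)\<^sup>2 < (1 / Suc N)\<^sup>2"
      using member_le_sum[of k "{..<N}" "\<lambda>k. ((\<integral>x. x ^ k \<partial>\<mu> N) - m k)\<^sup>2"] that approx[of N]
      by (simp add: \<mu>_eq)
    then show ?thesis
      by - (rule power2_less_imp_less, simp_all only: power2_abs, simp)
  qed
  have lim: "(\<lambda>N. \<integral>x. x ^ k \<partial>\<mu> N) \<longlonglongrightarrow> m k" for k
  proof (rule LIM_zero_cancel, rule Lim_null_comparison[OF _ inv0])
    show "\<forall>\<^sub>F N in sequentially. norm ((\<integral>x. x ^ k \<partial>\<mu> N) - m k) \<le> 1 / Suc N"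
      using eventually_gt_at_top[of k] by (rule eventually_mono) (use close less_imp_le in \<open>fastforce simp: real_norm_def\<close>)
  qed
  obtain B where B: "\<And>N. norm (\<integral>x. x\<^sup>2 \<partial>\<mu> N) \<le> B"
    using convergent_imp_Bseq[OF convergentI[OF lim[of 2]]] unfolding Bseq_def by blast
  have "tight \<mu>"
  proof (rule tight_of_bounded_second_moments[OF \<mu> int])
    show "(\<integral>x. x\<^sup>2 \<partial>\<mu> N) \<le> B" for N
      using B[of N] by simp
  qed
  then obtain r \<nu> where "strict_mono r" and \<nu>: "real_distribution \<nu>" and wc: "weak_conv_m (\<mu> \<circ> id \<circ> r) \<nu>"
    using tight_imp_convergent_subsubsequence[of \<mu> id] by (auto simp: strict_mono_id)
  have wc': "weak_conv_m (\<lambda>i. \<mu> (r i)) \<nu>"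
    using wc by (simp add: comp_def)
  have lim': "(\<lambda>i. \<integral>x. x ^ k \<partial>\<mu> (r i)) \<longlonglongrightarrow> m k" for k
    using LIMSEQ_subseq_LIMSEQ[OF lim \<open>strict_mono r\<close>] by (simp add: comp_def)
  \<comment> \<open>Fatou gives integrability for even orders only, so order \<open>k\<close> is
    obtained from order \<open>2 * k\<close>.\<close>
  have "integrable \<nu> (\<lambda>x. x ^ k)" for k
    by (rule real_distribution.integrable_power_of_even[OF \<nu> weak_limit_even_moment_bound(1)[OF \<mu> \<nu> wc' int lim']])
  moreover have "(\<integral>x. x ^ k \<partial>\<nu>) = m k" for k
    by (rule moments_of_weak_limit[OF \<mu> \<nu> wc' int lim' lim'])
  ultimately show ?thesis using \<nu> by blast
qed

subsection \<open>Measures on sequences of powers\<close>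

lemma space_rbar_borel [simp]: "space rbar_borel = UNIV"
  by (simp add: rbar_borel_def)

lemma openin_rbar_in_sets:
  "openin (Alexandroff_compactification euclideanreal) U \<Longrightarrow> U \<in> sets rbar_borel"
  by (simp add: rbar_borel_def sigma_sets.Basic)

text \<open>Only the generating open sets need testing: their preimage is an open \<open>V\<close>,
  or, for a neighbourhood of infinity, the complement of a closed \<open>V\<close>.\<close>

lemma measurable_Some_rbar_borel [measurable]: "Some \<in> measurable borel rbar_borel"
  unfolding rbar_borel_def
proof (rule measurable_measure_of)
  fix U :: "rbar set"
  assume "U \<in> {U. openin (Alexandroff_compactification euclideanreal) U}"
  then consider V where "U = Some ` V" "open V"
    | V where "U = insert None (Some ` (- V))" "closed V"
    by (auto simp: openin_Alexandroff_compactification Compl_eq_Diff_UNIV)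
  then show "Some -` U \<inter> space borel \<in> sets borel"
  proof cases
    case 1
    then have "Some -` U = V" by auto
    with 1 show ?thesis by simp
  next
    case 2
    then have "Some -` U = - V" by auto
    with 2 show ?thesis by (simp add: borel_open)
  qed
qed auto

text \<open>Induction over the generation of the Borel sets. The image of a complement is a
  complement within \<open>range Some\<close>, so measurability of that range, an open set, comes
  first.\<close>

lemma Some_image_in_sets_rbar_borel:
  assumes "A \<in> sets borel"
  shows "Some ` A \<in> sets rbar_borel"
proof -
  have UNIV: "range Some \<in> sets rbar_borel"
    by (rule openin_rbar_in_sets) (use open_UNIV in \<open>auto simp: openin_Alexandroff_compactification\<close>)
  from assms have "A \<in> sigma_sets UNIV {S. open S}" by (simp add: borel_def)
  then show ?thesis
  proof (induction rule: sigma_sets.induct)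
    case (Basic S)
    then show ?case
      by (intro openin_rbar_in_sets) (auto simp: openin_Alexandroff_compactification)
  next
    case (Compl S)
    have "Some ` (UNIV - S) = range Some - Some ` S" by auto
    then show ?case using UNIV Compl.IH by auto
  next
    case (Union S)
    then show ?case by (simp add: image_UN sets.countable_UN')
  qed simp
qed

text \<open>\<open>rbar_borel\<close> is the Borel line together with one measurable atom
  \<open>None\<close>, so a map is measurable as soon as its restriction to the finite points
  is.\<close>

lemma measurable_from_rbar_borel:
  assumes [measurable]: "(\<lambda>x. f (Some x)) \<in> measurable borel N" and "f None \<in> space N"
  shows "f \<in> measurable rbar_borel N"
proof (rule measurableI)
  fix x show "f x \<in> space N"
    using assms(2) measurable_space[OF assms(1)] by (cases x) auto
next
  fix A assume [measurable]: "A \<in> sets N"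
  have B: "(\<lambda>x. f (Some x)) -` A \<in> sets borel"
    using measurable_sets[OF assms(1) \<open>A \<in> sets N\<close>] by simp
  have None: "{None} \<in> sets rbar_borel"
  proof -
    have "{None} = UNIV - range (Some :: real \<Rightarrow> rbar)" by (auto simp: UNIV_option_conv)
    then show ?thesis
      using sets.compl_sets[OF Some_image_in_sets_rbar_borel[of UNIV]] by simp
  qed
  have "f -` A = Some ` ((\<lambda>x. f (Some x)) -` A) \<union> (if f None \<in> A then {None} else {})"
    (is "?L = ?R")
  proof (rule set_eqI)
    show "y \<in> ?L \<longleftrightarrow> y \<in> ?R" for y
      by (cases y) auto
  qed
  then show "f -` A \<inter> space rbar_borel \<in> sets rbar_borel"
    using Some_image_in_sets_rbar_borel[OF B] sets.Un[OF Some_image_in_sets_rbar_borel[OF B] None]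
    by simp
qed

lemma measurable_rbar_real [measurable]: "rbar_real \<in> borel_measurable rbar_borel"
  by (rule measurable_from_rbar_borel) simp_all

lemma measurable_rbar_abs [measurable]: "rbar_abs \<in> borel_measurable rbar_borel"
  by (rule measurable_from_rbar_borel) simp_all

lemma space_restrict_Omega_Han: "space (restrict_space Omega Omega_Han) = Omega_Han"
  by (auto simp: space_restrict_space Omega_Han_def)

lemma measurable_coordinate_Omega_Han:
  "(\<lambda>\<omega>. \<omega> k) \<in> measurable (restrict_space Omega Omega_Han) rbar_borel"
  unfolding Omega_def by (intro measurable_restrict_space1 measurable_component_singleton) simp

text \<open>Parametrises \<open>Omega_Han\<close> by its first coordinate, missing only the single
  point whose first coordinate is infinite.\<close>

definition powers_sequence :: "real \<Rightarrow> nat \<Rightarrow> rbar" where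
  "powers_sequence x k = Some (x ^ k)"

lemma powers_sequence_in_Omega_Han: "powers_sequence x \<in> Omega_Han"
  by (auto simp: Omega_Han_def Omega_def powers_sequence_def space_PiM)

lemma measurable_powers_sequence:
  "powers_sequence \<in> measurable borel (restrict_space Omega Omega_Han)"
proof (rule measurable_restrict_space2)
  show "powers_sequence \<in> measurable borel Omega"
    unfolding Omega_def
  proof (rule measurable_PiM_single')
    show "(\<lambda>x. powers_sequence x k) \<in> measurable borel rbar_borel" for k
      unfolding powers_sequence_def by measurable
  qed auto
qed (use powers_sequence_in_Omega_Han in auto)

section \<open>The two implications for Hankel matrices\<close>

lemma hankel_iff: "hankel M \<longleftrightarrow> (\<exists>m. \<forall>j k. M j k = m (j + k))"
proof
  assume h: "hankel M"
  have "M j k = M 0 (j + k)" for j k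
  proof -
    \<comment> \<open>Shifting by the full row index moves the entry into row 0, which serves as the
      sequence \<open>m\<close>.\<close>
    have "M j k = M (j - j) (k + j)"
      using h unfolding hankel_def by blast
    then show ?thesis by (simp add: add.commute)
  qed
  then show "\<exists>m. \<forall>j k. M j k = m (j + k)" by blast
qed (auto simp: hankel_def)

text \<open>On \<open>Omega_Han\<close> the product of coordinates \<open>j\<close> and
  \<open>k\<close> is coordinate \<open>j + k\<close>, also at infinity, so the integral sees only
  \<open>j + k\<close>.\<close>

lemma has_moment_matrix_imp_hankel:
  assumes "prob_measure_on_Omega_Han P" "has_moment_matrix P M"
  shows "hankel M"
proof -
  have "sets P = sets (restrict_space Omega Omega_Han)"
    using assms(1) unfolding prob_measure_on_Omega_Han_def by simp
  then have sp: "space P = Omega_Han"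
    by (simp only: sets_eq_imp_space_eq[of P] space_restrict_Omega_Han)
  have "M j k = (\<integral>\<omega>. rbar_real (\<omega> (j + k)) \<partial>P)" for j k
  proof -
    have "M j k = (\<integral>\<omega>. rbar_real (rbar_mult (\<omega> j) (\<omega> k)) \<partial>P)"
      using assms(2) unfolding has_moment_matrix_def rbar_has_integral_def by simp
    also have "\<dots> = (\<integral>\<omega>. rbar_real (\<omega> (j + k)) \<partial>P)"
      by (intro Bochner_Integration.integral_cong) (simp_all add: sp Omega_Han_mult)
    finally show ?thesis .
  qed
  then show ?thesis
    unfolding hankel_iff by (intro exI[of _ "\<lambda>n. \<integral>\<omega>. rbar_real (\<omega> n) \<partial>P"]) simp
qed

lemma moment_matrix_of_real_distribution:
  assumes \<nu>: "real_distribution \<nu>" and int: "\<And>k. integrable \<nu> (\<lambda>x. x ^ k)"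
  defines "P \<equiv> distr \<nu> (restrict_space Omega Omega_Han) powers_sequence"
  shows "prob_measure_on_Omega_Han P" and "has_moment_matrix P (\<lambda>j k. \<integral>x. x ^ (j + k) \<partial>\<nu>)"
proof -
  interpret real_distribution \<nu> by fact
  have T [measurable]: "powers_sequence \<in> measurable \<nu> (restrict_space Omega Omega_Han)"
    using measurable_powers_sequence by (simp cong: measurable_cong_sets)
  show "prob_measure_on_Omega_Han P"
    unfolding prob_measure_on_Omega_Han_def P_def by (simp add: prob_space_distr T)
  note [measurable] = measurable_coordinate_Omega_Han
  have "rbar_has_integral P (\<lambda>\<omega>. rbar_mult (\<omega> j) (\<omega> k)) (\<integral>x. x ^ (j + k) \<partial>\<nu>)" for j k
  proof -
    \<comment> \<open>On \<open>Omega_Han\<close> this product agrees with coordinate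
      \<open>j + k\<close>, whose measurability is known.\<close>
    have meas [measurable]: "(\<lambda>\<omega>. rbar_mult (\<omega> j) (\<omega> k)) \<in> measurable (restrict_space Omega Omega_Han) rbar_borel"
      using measurable_coordinate_Omega_Han[of "j + k"]
      by (rule measurable_cong[THEN iffD1, rotated]) (simp add: Omega_Han_mult space_restrict_Omega_Han)
    have mult: "rbar_mult (powers_sequence x j) (powers_sequence x k) = Some (x ^ (j + k))" for x
      by (simp add: powers_sequence_def power_add)
    have "(\<integral>\<^sup>+\<omega>. rbar_abs (rbar_mult (\<omega> j) (\<omega> k)) \<partial>P) = (\<integral>\<^sup>+x. ennreal (norm (x ^ (j + k))) \<partial>\<nu>)"
      unfolding P_def by (subst nn_integral_distr) (simp_all add: mult)
    also have "\<dots> < \<infinity>"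
      using int[of "j + k"] by (simp add: integrable_iff_bounded)
    finally have fin: "(\<integral>\<^sup>+\<omega>. rbar_abs (rbar_mult (\<omega> j) (\<omega> k)) \<partial>P) < \<infinity>" .
    have "(\<integral>\<omega>. rbar_real (rbar_mult (\<omega> j) (\<omega> k)) \<partial>P) = (\<integral>x. x ^ (j + k) \<partial>\<nu>)"
      unfolding P_def by (subst integral_distr) (simp_all add: mult)
    with fin show ?thesis
      unfolding rbar_has_integral_def by (simp add: P_def meas)
  qed
  then show "has_moment_matrix P (\<lambda>j k. \<integral>x. x ^ (j + k) \<partial>\<nu>)"
    unfolding has_moment_matrix_def by blast
qed

theorem theorem2p10:
  fixes M :: "nat \<Rightarrow> nat \<Rightarrow> real"
  assumes "pos_semidef M"
    and "M 0 0 = 1"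
  shows "(\<exists>P. prob_measure_on_Omega_Han P \<and> has_moment_matrix P M) \<longleftrightarrow> hankel M"
proof
  assume "hankel M"
  then obtain m where m: "M = (\<lambda>j k. m (j + k))"
    unfolding hankel_iff by blast
  then have "0 \<le> moment_functional m (p\<^sup>2)" for p
    using assms(1) pos_semidef_moment_functional_power2 by blast
  moreover have "m 0 = 1"
    using assms(2) by (simp add: m)
  ultimately obtain \<nu> where "real_distribution \<nu>" "\<And>k. integrable \<nu> (\<lambda>x. x ^ k)" "\<And>k. (\<integral>x. x ^ k \<partial>\<nu>) = m k"
    using hamburger_moment_problem by blast
  then show "\<exists>P. prob_measure_on_Omega_Han P \<and> has_moment_matrix P M"
    using moment_matrix_of_real_distribution[of \<nu>] by (auto simp: m)
qed (use has_moment_matrix_imp_hankel in blast)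

end
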